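(* Consider the price-coupling game $\mathcal{E}_1$ (price-anticipative formulation). Suppose the functions $g_i$, $i\in\mathcal{N}$, admit a potential function $\pi : X\to\mathbb{R}$. Consider the optimization problem $\mathbb{P}^1$: maximize $h(p,x)+\pi(x)$ over $(x,p)\in\mathcal{F}^1$. If $(x^*,p^* )\in\mathcal{F}^1$ is a maximizer of $\mathbb{P}^1$, then $(x^*,p^* )$ is an equilibrium of the game $\mathcal{E}_1$.
   Context: Setting: $\mathcal{N}=\{1,\dots,N\}$ is the set of players; $X_i\subseteq\mathbb{R}^{m_i}$ is the decision set of player $i$; $X=\prod_{i\in\mathcal{N}}X_i$; $x=(x_1,\dots,x_N)\in X$; $x^{-i}=(x_1,\dots,x_{i-1},x_{i+1},\dots,x_N)\in X^{-i}=\prod_{j\ne i}X_j$; one writes $x=(x_i,x^{-i})$. Prices $p$ lie in a Euclidean space $\mathbb{R}^k$. $h:\mathbb{R}^k\times X\to\mathbb{R}$ (written $h(p,x)$) is common to all players, and $g_i:X\to\mathbb{R}$ is specific to player $i$. Price-determining player: for $x\in X$, $\mathcal{S}(x)$ is the problem of minimizing $f(x,p)$ over $p\in\mathcal{M}(x)$, where $f:X\times\mathbb{R}^k\to\mathbb{R}$ and $\mathcal{M}$ is a set-valued map assigning to each $x\in X$ a set $\mathcal{M}(x)\subseteq\mathbb{R}^k$. $\mathrm{SOL}[\mathcal{S}(x)]$ is the set of minimizers of $\mathcal{S}(x)$. Game $\mathcal{E}_1$: given $x^{-i}$, player $i$ maximizes $h(p_i,x)+g_i(x)$ over $(x_i,p_i)\in\Omega_i(x^{-i})=\{(x_i,p_i)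 : x_i\in X_i,\ p_i\in\mathrm{SOL}[\mathcal{S}(x)]\}$, where $x=(x_i,x^{-i})$. Let $\mathcal{F}^1=\{(x,p) : x_i\in X_i\ \forall i\in\mathcal{N},\ p\in\mathrm{SOL}[\mathcal{S}(x)]\}$. A point $(x^*,p^* )\in\mathcal{F}^1$ is an equilibrium of $\mathcal{E}_1$ if for all $i\in\mathcal{N}$, $h(p^*,x^* )+g_i(x^* )\ge h(p_i,x_i,x^{-i*})+g_i(x_i,x^{-i*})$ for all $(x_i,p_i)\in\Omega_i(x^{-i*})$. The functions $g_i$, $i\in\mathcal{N}$, admit a potential function $\pi:X\to\mathbb{R}$ if for all $i\in\mathcal{N}$, all $x^{-i}\in X^{-i}$ and all $\tilde{x}_i,\hat{x}_i\in X_i$: $g_i(\tilde{x}_i,x^{-i})-g_i(\hat{x}_i,x^{-i})=\pi(\tilde{x}_i,x^{-i})-\pi(\hat{x}_i,x^{-i})$. *)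

theory Defs
  imports "HOL-Analysis.Analysis"
begin

(* The dimensions m_1, ..., m_N vary with the player, so R^n is an explicit carrier here:
   functions nat => real with coordinates in {1..n} and value undefined elsewhere. *)
definition Rn :: "nat \<Rightarrow> (nat \<Rightarrow> real) set" where
  "Rn n = {1..n} \<rightarrow>\<^sub>E UNIV"

type_synonym profile = "nat \<Rightarrow> nat \<Rightarrow> real"

definition profiles :: "nat \<Rightarrow> (nat \<Rightarrow> (nat \<Rightarrow> real) set) \<Rightarrow> profile set" where
  "profiles N X = (\<Pi>\<^sub>E i\<in>{1..N}. X i)"

definition rival_profiles :: "nat \<Rightarrow> (nat \<Rightarrow> (nat \<Rightarrow> real) set) \<Rightarrow> nat \<Rightarrow> profile set" where
  "rival_profiles N X i = (\<Pi>\<^sub>E j\<in>{1..N} - {i}. X j)"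

definition rivals :: "nat \<Rightarrow> nat \<Rightarrow> profile \<Rightarrow> profile" where
  "rivals N i x = restrict x ({1..N} - {i})"

(* the profile (x_i, x^{-i}) *)
definition join :: "nat \<Rightarrow> (nat \<Rightarrow> real) \<Rightarrow> profile \<Rightarrow> profile" where
  "join i a y = y(i := a)"

definition SOL :: "(profile \<Rightarrow> real ^ 'k \<Rightarrow> real) \<Rightarrow> (profile \<Rightarrow> (real ^ 'k) set)
    \<Rightarrow> profile \<Rightarrow> (real ^ 'k) set" where
  "SOL f M x = {p. is_arg_min (f x) (\<lambda>q. q \<in> M x) p}"

definition Omega :: "(nat \<Rightarrow> (nat \<Rightarrow> real) set) \<Rightarrow> (profile \<Rightarrow> real ^ 'k \<Rightarrow> real)
    \<Rightarrow> (profile \<Rightarrow> (real ^ 'k) set) \<Rightarrow> nat \<Rightarrow> profile \<Rightarrow> ((nat \<Rightarrow> real) \<times> (real ^ 'k)) set" where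
  "Omega X f M i y = {(a, q). a \<in> X i \<and> q \<in> SOL f M (join i a y)}"

definition F1 :: "nat \<Rightarrow> (nat \<Rightarrow> (nat \<Rightarrow> real) set) \<Rightarrow> (profile \<Rightarrow> real ^ 'k \<Rightarrow> real)
    \<Rightarrow> (profile \<Rightarrow> (real ^ 'k) set) \<Rightarrow> (profile \<times> (real ^ 'k)) set" where
  "F1 N X f M = {(x, p). x \<in> profiles N X \<and> p \<in> SOL f M x}"

definition equilibrium_E1 :: "nat \<Rightarrow> (nat \<Rightarrow> (nat \<Rightarrow> real) set)
    \<Rightarrow> (profile \<Rightarrow> real ^ 'k \<Rightarrow> real) \<Rightarrow> (profile \<Rightarrow> (real ^ 'k) set)
    \<Rightarrow> (real ^ 'k \<Rightarrow> profile \<Rightarrow> real) \<Rightarrow> (nat \<Rightarrow> profile \<Rightarrow> real)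
    \<Rightarrow> profile \<Rightarrow> real ^ 'k \<Rightarrow> bool" where
  "equilibrium_E1 N X f M h g x p \<longleftrightarrow>
     (x, p) \<in> F1 N X f M \<and>
     (\<forall>i\<in>{1..N}. \<forall>(a, q)\<in>Omega X f M i (rivals N i x).
        h p x + g i x \<ge> h q (join i a (rivals N i x)) + g i (join i a (rivals N i x)))"

definition potential :: "nat \<Rightarrow> (nat \<Rightarrow> (nat \<Rightarrow> real) set) \<Rightarrow> (nat \<Rightarrow> profile \<Rightarrow> real)
    \<Rightarrow> (profile \<Rightarrow> real) \<Rightarrow> bool" where
  "potential N X g \<pi> \<longleftrightarrow>
     (\<forall>i\<in>{1..N}. \<forall>y\<in>rival_profiles N X i. \<forall>a\<in>X i. \<forall>b\<in>X i.
        g i (join i a y) - g i (join i b y) = \<pi> (join i a y) - \<pi> (join i b y))"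

end

theory Submission imports Defs begin

text \<open>When player i deviates from x to (a, x^{-i}) at a price q, the common term h enters the
  payoff of player i and the objective of the optimization problem in the same way, and the
  potential property says that \<open>g i\<close> and \<open>\<pi>\<close> change by the same amount. So the deviation changes
  the payoff of player i and the objective \<open>h p x + \<pi> x\<close> equally. The price q solves the
  pricing problem at the new profile, since the player anticipates the price response; hence the
  deviation is again a point of \<open>F1\<close>, and a profitable one would contradict maximality.\<close>

lemma join_rivals_self:
  assumes "x \<in> profiles N X" "i \<in> {1..N}"
  shows "join i (x i) (rivals N i x) = x"
proof
  fix j
  show "join i (x i) (rivals N i x) j = x j"
    using PiE_arb[OF assms(1)[unfolded profiles_def], of j] assms(2)
    by (cases "j \<in> {1..N}") (simp_all add: join_def rivals_def)
qed

lemma join_rivals_in_profiles: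
  assumes "x \<in> profiles N X" "i \<in> {1..N}" "a \<in> X i"
  shows "join i a (rivals N i x) \<in> profiles N X"
  using assms by (auto simp: join_def rivals_def profiles_def PiE_iff extensional_def)

lemma rivals_in_rival_profiles:
  assumes "x \<in> profiles N X"
  shows "rivals N i x \<in> rival_profiles N X i"
  using assms by (auto simp: rivals_def rival_profiles_def profiles_def PiE_iff)

theorem mainTheorem1:
  fixes N :: nat and m :: "nat \<Rightarrow> nat"
    and X :: "nat \<Rightarrow> (nat \<Rightarrow> real) set"
    and f :: "profile \<Rightarrow> real ^ 'k \<Rightarrow> real"
    and M :: "profile \<Rightarrow> (real ^ 'k) set"
    and h :: "real ^ 'k \<Rightarrow> profile \<Rightarrow> real"
    and g :: "nat \<Rightarrow> profile \<Rightarrow> real"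
    and \<pi> :: "profile \<Rightarrow> real"
    and xs :: profile and ps :: "real ^ 'k"
  assumes "\<And>i. i \<in> {1..N} \<Longrightarrow> X i \<subseteq> Rn (m i)"
    and "potential N X g \<pi>"
    and "is_arg_max (\<lambda>(x, p). h p x + \<pi> x) (\<lambda>z. z \<in> F1 N X f M) (xs, ps)"
  shows "equilibrium_E1 N X f M h g xs ps"
proof -
  have feasible: "(xs, ps) \<in> F1 N X f M"
    using assms(3) by (simp add: is_arg_max_def)
  hence prof: "xs \<in> profiles N X"
    by (simp add: F1_def)
  have "h q (join i a (rivals N i xs)) + g i (join i a (rivals N i xs)) \<le> h ps xs + g i xs"
    if i: "i \<in> {1..N}" and dev: "(a, q) \<in> Omega X f M i (rivals N i xs)" for i a q
  proof -
    let ?y = "join i a (rivals N i xs)"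
    have a: "a \<in> X i" and q: "q \<in> SOL f M ?y"
      using dev by (auto simp: Omega_def)
    have "(?y, q) \<in> F1 N X f M"
      using q join_rivals_in_profiles[where X=X, OF prof i a] by (simp add: F1_def)
    hence "h q ?y + \<pi> ?y \<le> h ps xs + \<pi> xs"
      using assms(3) by (auto simp: is_arg_max_def not_less)
    moreover have "xs i \<in> X i"
      using prof i by (auto simp: profiles_def)
    \<comment> \<open>The potential property compares two strategies against the same rivals; the second one
      is \<open>xs i\<close> itself, which restores the profile \<open>xs\<close>.\<close>
    hence "g i ?y - g i (join i (xs i) (rivals N i xs))
        = \<pi> ?y - \<pi> (join i (xs i) (rivals N i xs))"
      using assms(2) i a rivals_in_rival_profiles[OF prof, of i]
      by (simp add: potential_def)
    hence "g i ?y - g i xs = \<pi> ?y - \<pi> xs"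
      by (simp only: join_rivals_self[OF prof i])
    ultimately show ?thesis by linarith
  qed
  thus ?thesis
    using feasible by (auto simp: equilibrium_E1_def)
qed

end
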